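(* Let $n\ge k$ and let $P=T^k$ be the $k$-dimensional torus. Then the $P$-category of the $n$-dimensional torus $T^n$ equals $$T^k\text{-}\mathrm{cat}\, T^n = n-k+1.$$
   Context: **$P$-category.** Let $X$ be a Hausdorff space and $P\subset X$ a closed subset. $P\text{-}\mathrm{cat}\,X$ is the minimal number $k$ of closed subsets $A_1,\dots,A_k$ of $X$ such that $X=\bigcup_{i=1}^k A_i$ and each $A_i$ is contractible within $X$ to $P$, i.e. for each $i$ there is a homotopy $F_i\colon A_i\times[0,1]\to X$ with $F_i(x,0)=x$ for $x\in A_i$, and $F_i(A_i\times\{1\})=P_i\subset X$ where $P_i$ is homeomorphic to $P$. If no such $k$ exists, $P\text{-}\mathrm{cat}\,X=\infty$. Here $T^k=(S^1)^k$ is regarded as the standard subtorus of $T^n=(S^1)^n$. *)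

theory Defs
  imports "HOL-Analysis.Analysis"
begin

definition contractible_within_to :: "'a topology \<Rightarrow> 'a set \<Rightarrow> 'a set \<Rightarrow> bool" where
  "contractible_within_to X P A \<longleftrightarrow>
     (\<exists>g. homotopic_with (\<lambda>_. True) (subtopology X A) X id g \<and>
          subtopology X (g ` A) homeomorphic_space subtopology X P)"

text \<open>\<open>A\<close> is the closed set being contracted: there is a homotopy from the inclusion of \<open>A\<close> into \<open>X\<close>
  to a map \<open>g\<close>. The final image \<open>g ` A\<close> has to be all of a homeomorphic copy of \<open>P\<close>, not merely
  contained in one. The infimum is \<open>\<infinity>\<close> if there is no finite cover of the required kind. The
  notion is intended for a Hausdorff space \<open>X\<close> and a closed subset \<open>P\<close>.\<close>

definition pcat :: "'a topology \<Rightarrow> 'a set \<Rightarrow> enat" where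
  "pcat X P = Inf {enat m | m. \<exists>A :: nat \<Rightarrow> 'a set.
     (\<forall>i\<in>{1..m}. closedin X (A i) \<and> contractible_within_to X P (A i)) \<and>
     topspace X = (\<Union>i\<in>{1..m}. A i)}"

definition torus :: "nat \<Rightarrow> (nat \<Rightarrow> complex) topology" where
  "torus n = product_topology (\<lambda>_. top_of_set (sphere 0 1)) {..<n}"

text \<open>The standard copy of the \<open>k\<close>-torus in the \<open>n\<close>-torus: the last \<open>n - k\<close> coordinates are at the
  base point of the circle.\<close>

definition subtorus :: "nat \<Rightarrow> nat \<Rightarrow> (nat \<Rightarrow> complex) set" where
  "subtorus n k = {x \<in> topspace (torus n). \<forall>i\<in>{k..<n}. x i = 1}"

lemma Hausdorff_space_torus: "Hausdorff_space (torus n)"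
  unfolding torus_def Hausdorff_space_product_topology
  by (intro disjI2 ballI Hausdorff_space_subtopology Hausdorff_space_euclidean)

lemma closedin_subtorus: "closedin (torus n) (subtorus n k)"
proof -
  have "closedin (torus n) {x \<in> topspace (torus n). x i = 1}" if "i \<in> {k..<n}" for i
  proof -
    have "continuous_map (torus n) (top_of_set (sphere 0 1)) (\<lambda>x. x i)"
      unfolding torus_def using that by (intro continuous_map_product_projection) simp
    then have "closedin (torus n) {x \<in> topspace (torus n). x i \<in> {1}}"
      by (rule closedin_continuous_map_preimage) (auto intro: closed_subset)
    then show ?thesis by simp
  qed
  then have "closedin (torus n) (\<Inter>i\<in>{k..<n}. {x \<in> topspace (torus n). x i = 1})"
    if "k < n"
    using that by (intro closedin_INT) auto
  moreover have "subtorus n k = (if k < n then \<Inter>i\<in>{k..<n}. {x \<in> topspace (torus n). x i = 1}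
      else topspace (torus n))"
  proof (cases "k < n")
    case True
    then have "k \<in> {k..<n}"
      by simp
    with True show ?thesis
      unfolding subtorus_def by auto
  qed (simp add: subtorus_def)
  ultimately show ?thesis
    by simp
qed

lemma subtorus_homeomorphic_torus:
  assumes "k \<le> n"
  shows "subtopology (torus n) (subtorus n k) homeomorphic_space torus k"
proof -
  let ?f = "\<lambda>x::nat \<Rightarrow> complex. restrict x {..<k}"
  let ?g = "\<lambda>x::nat \<Rightarrow> complex. \<lambda>i\<in>{..<n}. if i < k then x i else 1"
  have f: "continuous_map (subtopology (torus n) (subtorus n k)) (torus k) ?f"
    unfolding torus_def using assms
    by (intro continuous_map_from_subtopology)
       (auto simp: continuous_map_componentwise
             intro!: continuous_map_product_projection)
  have "continuous_map (torus k) (top_of_set (sphere 0 1)) (\<lambda>x. if i < k then x i else 1)" for i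
    unfolding torus_def by (cases "i < k") (auto intro!: continuous_map_product_projection)
  then have "continuous_map (torus k) (torus n) ?g"
    unfolding torus_def[of n] by (auto simp: continuous_map_componentwise)
  moreover have "?g ` topspace (torus k) \<subseteq> subtorus n k"
  proof (rule image_subsetI)
    fix x assume "x \<in> topspace (torus k)"
    then have "norm (x i) = 1" if "i < k" for i
      using that by (simp add: torus_def PiE_iff)
    then show "?g x \<in> subtorus n k"
      by (simp add: subtorus_def torus_def PiE_iff)
  qed
  ultimately have g: "continuous_map (torus k) (subtopology (torus n) (subtorus n k)) ?g"
    by (auto simp: continuous_map_in_subtopology image_subset_iff_funcset)
  have "homeomorphic_maps (subtopology (torus n) (subtorus n k)) (torus k) ?f ?g"
    unfolding homeomorphic_maps_def
  proof (intro conjI ballI)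
    show "?g (?f x) = x" if "x \<in> topspace (subtopology (torus n) (subtorus n k))" for x
    proof
      fix i
      have "x i = undefined" if "\<not> i < n"
        using \<open>x \<in> _\<close> that by (auto simp: subtorus_def torus_def PiE_def extensional_def)
      moreover have "x i = 1" if "i < n" "\<not> i < k"
        using \<open>x \<in> _\<close> that by (simp add: subtorus_def)
      ultimately show "?g (?f x) i = x i"
        by simp
    qed
    show "?f (?g x) = x" if "x \<in> topspace (torus k)" for x
    proof
      fix i
      have "x i = undefined" if "\<not> i < k"
        using \<open>x \<in> _\<close> that by (simp add: torus_def PiE_def extensional_def)
      then show "?f (?g x) i = x i"
        using assms by (cases "i < k") auto
    qed
  qed (fact f g)+
  then show ?thesis
    unfolding homeomorphic_space_def by blast
qed

end

theory Submission
  imports Defs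
begin

text \<open>Lower bound. Let \<open>A\<close> be deformed inside \<open>T\<^sup>n\<close> onto a copy of \<open>T\<^sup>k\<close>. The restriction
  \<open>H\<^sup>1(T\<^sup>n) \<rightarrow> H\<^sup>1(A)\<close> factors through \<open>H\<^sup>1(T\<^sup>k) = \<int>\<^sup>k\<close>, so its kernel has rank at least \<open>n - k\<close>. If \<open>m \<le> n - k\<close>
  such sets covered \<open>T\<^sup>n\<close>, one could choose linearly independent classes \<open>\<alpha> 0, ..., \<alpha> (m - 1)\<close>, the \<open>i\<close>-th of them
  vanishing on the \<open>i\<close>-th set. Their cup product would vanish on the whole torus, but in the exterior
  algebra \<open>H\<^sup>*(T\<^sup>n)\<close> a product of independent classes of degree 1 is nonzero.

  The proof below makes this elementary. A class in \<open>H\<^sup>1\<close> of a space is a homotopy class of maps to the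
  circle, which is trivial if the map has a continuous real logarithm; the classes of \<open>T\<^sup>n\<close> are the
  monomials \<open>\<Prod>l<n. x l powi \<alpha> l\<close>. The factorisation through \<open>H\<^sup>1(T\<^sup>k)\<close> becomes
  \<open>contractible_within_torus_logs\<close>, which rests on the computation of the circle-valued maps on
  \<open>T\<^sup>k\<close> in \<open>circle_map_on_torus\<close> and on the logarithm of a homotopy in \<open>circle_homotopy_log\<close>. The
  logarithms on the sets of the cover extend to bounded functions on the torus. Divide the \<open>m\<close> monomials
  by the exponentials of these functions. At every point of the torus one of the quotients is 1, so the
  resulting map \<open>T\<^sup>n \<rightarrow> T\<^sup>m\<close> avoids \<open>(-1, ..., -1)\<close>. On a suitable subtorus \<open>T\<^sup>m\<close> this map lifts to a bounded
  perturbation of an invertible linear map of \<open>\<real>\<^sup>m\<close>, which is onto by the Poincare-Miranda theorem: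
  \<open>triangular_bounded_system\<close>. This contradiction is \<open>contractible_cover_card_ge\<close>.

  Upper bound. Remove from the circle one of \<open>n - k + 1\<close> disjoint open arcs; what is left contracts to
  the base point. Let the \<open>i\<close>-th set consist of the points whose last \<open>n - k\<close> coordinates all avoid the
  \<open>i\<close>-th arc. It contracts onto the standard \<open>T\<^sup>k\<close>, and as \<open>n - k\<close> coordinates can meet at most \<open>n - k\<close> of
  the \<open>n - k + 1\<close> arcs, the sets cover the torus (\<open>contractible_within_to_arc_product\<close>,
  \<open>arc_products_cover\<close>).\<close>

section \<open>Zeros of continuous maps on boxes\<close>

text \<open>The dimension \<open>m\<close> is the size of a cover and has to be a variable, so vectors are functions on \<open>nat\<close>.
  Coordinates beyond \<open>m\<close> are pinned to 0, rather than to \<open>undefined\<close>, so that they survive scaling.\<close>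
definition nat_box :: "nat \<Rightarrow> (nat \<Rightarrow> real) \<Rightarrow> (nat \<Rightarrow> real) \<Rightarrow> (nat \<Rightarrow> real) set" where
  "nat_box m a b = {x. \<forall>j. x j \<in> (if j < m then {a j..b j} else {0})}"

lemma compact_nat_box: "compact (nat_box m a b)"
proof -
  have "nat_box m a b = PiE UNIV (\<lambda>j. if j < m then {a j..b j} else {0})"
    unfolding nat_box_def PiE_def Pi_def by (simp split: if_splits)
  moreover have "compactin (product_topology (\<lambda>_. euclidean) UNIV)
      (PiE UNIV (\<lambda>j. if j < m then {a j..b j} else {0::real}))"
    by (auto simp: compactin_PiE)
  ultimately show ?thesis
    by (simp add: euclidean_product_topology)
qed

lemma tendsto_coordinatewise:
  fixes f :: "'a \<Rightarrow> 'b \<Rightarrow> 'c::topological_space"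
  shows "(f \<longlongrightarrow> l) F \<longleftrightarrow> (\<forall>i. ((\<lambda>x. f x i) \<longlongrightarrow> l i) F)"
  using limitin_componentwise[of "\<lambda>_. euclidean" UNIV f l F]
  by (simp add: euclidean_product_topology)

text \<open>Only evaluation at the bound variable is a safe rule for \<open>continuous_intros\<close>: with \<open>f x j\<close> in place of
  \<open>x j\<close>, the conclusion would unify with almost any function.\<close>
lemma continuous_on_eval [continuous_intros]: "continuous_on S (\<lambda>x. x j)"
  by (rule continuous_on_product_then_coordinatewise[OF continuous_on_id])

text \<open>Kuhn's combinatorial lemma, applied to the grid with \<open>p\<close> steps per edge and vertices labelled by the signs
  of the coordinate functions, yields a grid cell in which every \<open>f i\<close> takes both signs. The face
  conditions on \<open>f\<close> are what makes the labelling admissible.\<close>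
lemma approximate_zeros:
  fixes f :: "nat \<Rightarrow> (nat \<Rightarrow> real) \<Rightarrow> real" and p :: nat
  assumes "0 < p"
    and ab: "\<And>j. j < m \<Longrightarrow> a j \<le> b j"
    and lo: "\<And>i x. i < m \<Longrightarrow> x \<in> nat_box m a b \<Longrightarrow> x i = a i \<Longrightarrow> f i x \<le> 0"
    and hi: "\<And>i x. i < m \<Longrightarrow> x \<in> nat_box m a b \<Longrightarrow> x i = b i \<Longrightarrow> 0 \<le> f i x"
  shows "\<exists>x \<in> nat_box m a b. \<forall>i<m. \<exists>y \<in> nat_box m a b. \<exists>z \<in> nat_box m a b.
           f i y \<le> 0 \<and> 0 \<le> f i z \<and>
           (\<forall>j. \<bar>y j - x j\<bar> \<le> (b j - a j) / p \<or> j \<ge> m) \<and>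
           (\<forall>j. \<bar>z j - x j\<bar> \<le> (b j - a j) / p \<or> j \<ge> m)"
proof -
  define P where "P q = (\<lambda>j. if j < m then a j + (b j - a j) * (real (q j) / real p) else 0)" for q :: "nat \<Rightarrow> nat"
  \<comment> \<open>Points of the upper face get label 1 even when \<open>f i\<close> vanishes there, as Kuhn's lemma demands.\<close>
  define label where "label q i = (if q i = p \<or> 0 < f i (P q) then 1 else 0 :: nat)" for q i
  have P: "P q \<in> nat_box m a b" if "\<forall>i<m. q i \<le> p" for q
  proof -
    have "a j + (b j - a j) * (real (q j) / real p) \<le> b j" if "j < m" for j
    proof -
      have "(b j - a j) * (real (q j) / real p) \<le> (b j - a j) * 1"
        using \<open>\<forall>i<m. q i \<le> p\<close> ab[OF that] that \<open>0 < p\<close>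
        by (intro mult_left_mono) (auto simp: divide_le_eq)
      then show ?thesis by simp
    qed
    then show ?thesis
      using ab by (auto simp: nat_box_def P_def)
  qed
  have P0: "P q i = a i" if "i < m" "q i = 0" for q i
    using that by (simp add: P_def)
  have Pp: "P q i = b i" if "i < m" "q i = p" for q i
    using that \<open>0 < p\<close> by (simp add: P_def)
  have l0: "f i (P q) \<le> 0" if "label q i = 0" for q i
    using that by (auto simp: label_def split: if_splits)
  have l1: "0 \<le> f i (P q)" if "label q i \<noteq> 0" "i < m" "\<forall>i<m. q i \<le> p" for q i
    using that hi[OF _ P Pp, of i q] by (auto simp: label_def split: if_splits)
  have c0: "\<forall>x. (\<forall>i<m. x i \<le> p) \<longrightarrow> (\<forall>i<m. x i = 0 \<longrightarrow> label x i = 0)"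
  proof (intro allI impI)
    fix x i assume "\<forall>i<m. x i \<le> p" "i < m" "x i = 0"
    then have "f i (P x) \<le> 0" by (intro lo P P0)
    then show "label x i = 0" using \<open>x i = 0\<close> \<open>0 < p\<close> by (simp add: label_def)
  qed
  obtain q where q: "\<forall>i<m. q i < p"
    and rs: "\<forall>i<m. \<exists>r s. (\<forall>j<m. q j \<le> r j \<and> r j \<le> q j + 1) \<and>
                 (\<forall>j<m. q j \<le> s j \<and> s j \<le> q j + 1) \<and> label r i \<noteq> label s i"
    by (rule kuhn_lemma[of p m label]) (use \<open>0 < p\<close> c0 in \<open>auto simp: label_def\<close>)
  have near: "\<bar>P r j - P q j\<bar> \<le> (b j - a j) / p"
    if "\<forall>j<m. q j \<le> r j \<and> r j \<le> q j + 1" "j < m" for r j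
  proof -
    have "P r j - P q j = (b j - a j) / p * (real (r j) - real (q j))"
      using that by (simp add: P_def diff_divide_distrib right_diff_distrib left_diff_distrib)
    moreover have "0 \<le> real (r j) - real (q j)" "real (r j) - real (q j) \<le> 1"
      using that(1)[rule_format, OF that(2)] by linarith+
    moreover have "0 \<le> (b j - a j) / p" using ab[OF \<open>j < m\<close>] by simp
    ultimately show ?thesis
      by (simp only: abs_mult abs_of_nonneg mult_left_le)
  qed
  show ?thesis
  proof (rule bexI[of _ "P q"], intro allI impI)
    fix i assume "i < m"
    then obtain r s where r: "\<forall>j<m. q j \<le> r j \<and> r j \<le> q j + 1"
      and s: "\<forall>j<m. q j \<le> s j \<and> s j \<le> q j + 1" and rs: "label r i = 0" "label s i \<noteq> 0"
      by (metis (no_types, lifting) rs label_def)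
    have "\<forall>j<m. r j \<le> p" "\<forall>j<m. s j \<le> p"
      using q r s by (metis Suc_eq_plus1 Suc_leI le_trans)+
    then show "\<exists>y \<in> nat_box m a b. \<exists>z \<in> nat_box m a b. f i y \<le> 0 \<and> 0 \<le> f i z \<and>
           (\<forall>j. \<bar>y j - P q j\<bar> \<le> (b j - a j) / p \<or> j \<ge> m) \<and>
           (\<forall>j. \<bar>z j - P q j\<bar> \<le> (b j - a j) / p \<or> j \<ge> m)"
      using l0[OF rs(1)] l1[OF rs(2) \<open>i < m\<close>] P near r s
      by (intro bexI[of _ "P r"] bexI[of _ "P s"]) (auto simp: not_le[symmetric])
  next
    show "P q \<in> nat_box m a b" using q by (intro P) (auto intro: less_imp_le)
  qed
qed

text \<open>Poincare-Miranda: the cells of \<open>approximate_zeros\<close> shrink, and by compactness some subsequence of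
  them converges to one point. At the limit each \<open>f i\<close> is both nonpositive and nonnegative.\<close>
lemma poincare_miranda:
  fixes f :: "nat \<Rightarrow> (nat \<Rightarrow> real) \<Rightarrow> real"
  assumes ab: "\<And>j. j < m \<Longrightarrow> a j \<le> b j"
    and cont: "\<And>i. i < m \<Longrightarrow> continuous_on (nat_box m a b) (f i)"
    and lo: "\<And>i x. i < m \<Longrightarrow> x \<in> nat_box m a b \<Longrightarrow> x i = a i \<Longrightarrow> f i x \<le> 0"
    and hi: "\<And>i x. i < m \<Longrightarrow> x \<in> nat_box m a b \<Longrightarrow> x i = b i \<Longrightarrow> 0 \<le> f i x"
  obtains x where "x \<in> nat_box m a b" "\<And>i. i < m \<Longrightarrow> f i x = 0"
proof -
  let ?B = "nat_box m a b"
  have "\<exists>x \<in> ?B. \<forall>i<m. \<exists>y \<in> ?B. \<exists>z \<in> ?B. f i y \<le> 0 \<and> 0 \<le> f i z \<and>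
      (\<forall>j. \<bar>y j - x j\<bar> \<le> (b j - a j) / Suc p \<or> j \<ge> m) \<and>
      (\<forall>j. \<bar>z j - x j\<bar> \<le> (b j - a j) / Suc p \<or> j \<ge> m)" for p
    using approximate_zeros[of "Suc p" m a b f] ab lo hi by simp
  then obtain X Y Z where X: "\<And>p. X p \<in> ?B"
    and YZ: "\<And>p i. i < m \<Longrightarrow> Y p i \<in> ?B \<and> Z p i \<in> ?B \<and> f i (Y p i) \<le> 0 \<and> 0 \<le> f i (Z p i) \<and>
      (\<forall>j. \<bar>Y p i j - X p j\<bar> \<le> (b j - a j) / Suc p \<or> j \<ge> m) \<and>
      (\<forall>j. \<bar>Z p i j - X p j\<bar> \<le> (b j - a j) / Suc p \<or> j \<ge> m)"
    by metis
  obtain l \<sigma> where l: "l \<in> ?B" and \<sigma>: "strict_mono \<sigma>" and lim: "(X \<circ> \<sigma>) \<longlonglongrightarrow> l"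
    using compact_nat_box[of m a b] X unfolding compact_eq_seq_compact_metric seq_compact_def by metis
  have near: "(\<lambda>p. W (\<sigma> p)) \<longlonglongrightarrow> l"
    if W: "\<And>p. W p \<in> ?B" "\<And>p j. \<bar>W p j - X p j\<bar> \<le> (b j - a j) / Suc p \<or> j \<ge> m" for W
    unfolding tendsto_coordinatewise
  proof
    fix j
    have 1: "(\<lambda>p. X (\<sigma> p) j) \<longlonglongrightarrow> l j"
      using lim by (simp add: tendsto_coordinatewise o_def)
    show "(\<lambda>p. W (\<sigma> p) j) \<longlonglongrightarrow> l j"
    proof (cases "j < m")
      case True
      have "(\<lambda>p. (b j - a j) / real (Suc p)) \<longlonglongrightarrow> 0"
        using LIMSEQ_Suc[OF lim_const_over_n[of "b j - a j"]] .
      from LIMSEQ_subseq_LIMSEQ[OF this \<sigma>]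
      have 2: "(\<lambda>p. (b j - a j) / real (Suc (\<sigma> p))) \<longlonglongrightarrow> 0"
        by (simp add: o_def)
      have "(\<lambda>p. W (\<sigma> p) j - X (\<sigma> p) j) \<longlonglongrightarrow> 0"
        by (rule Lim_null_comparison[OF _ 2]) (use W(2)[of "\<sigma> _" j] True in \<open>auto simp: not_le[symmetric] intro!: always_eventually\<close>)
      from tendsto_add[OF this 1] show ?thesis by simp
    next
      case False
      have "W p j = 0" "X p j = 0" for p
        using W(1)[of p] X[of p] False by (auto simp: nat_box_def dest!: spec[of _ j])
      then show ?thesis using 1 by simp
    qed
  qed
  have "f i l = 0" if "i < m" for i
  proof (rule antisym)
    have lim': "(\<lambda>p. f i (W (\<sigma> p))) \<longlonglongrightarrow> f i l"
      if "(\<lambda>p. W (\<sigma> p)) \<longlonglongrightarrow> l" "\<And>p. W p \<in> ?B" for W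
      using continuous_on_tendsto_compose[OF cont[OF \<open>i < m\<close>] that(1) l] that(2) by simp
    show "f i l \<le> 0"
      by (rule LIMSEQ_le_const2[OF lim'[OF near[of "\<lambda>p. Y p i"]]]) (use YZ[OF that] in \<open>auto\<close>)
    show "0 \<le> f i l"
      by (rule LIMSEQ_le_const[OF lim'[OF near[of "\<lambda>p. Z p i"]]]) (use YZ[OF that] in \<open>auto\<close>)
  qed
  with l show ?thesis by (rule that)
qed

section \<open>Integer vectors in kernels\<close>

text \<open>Fewer equations than unknowns: fraction-free Gaussian elimination. The last equation is used to
  eliminate an unknown \<open>p\<close> occurring in it; multiplying the remaining rows by the pivot entry keeps all
  coefficients integral.\<close>
lemma homogeneous_integer_solution:
  fixes B :: "nat \<Rightarrow> 'a \<Rightarrow> int"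
  assumes "finite N" "c < card N"
  shows "\<exists>v. (\<exists>i\<in>N. v i \<noteq> 0) \<and> (\<forall>r<c. (\<Sum>i\<in>N. v i * B r i) = 0)"
  using assms
proof (induction c arbitrary: N B)
  case 0
  then have "N \<noteq> {}" by auto
  then show ?case by (intro exI[of _ "\<lambda>_. 1"]) auto
next
  case (Suc c)
  show ?case
  proof (cases "\<forall>i\<in>N. B c i = 0")
    case True
    obtain v where "\<exists>i\<in>N. v i \<noteq> 0" "\<forall>r<c. (\<Sum>i\<in>N. v i * B r i) = 0"
      using Suc.IH[of N B] Suc.prems by auto
    with True show ?thesis
      by (intro exI[of _ v]) (auto simp: less_Suc_eq)
  next
    case False
    then obtain p where p: "p \<in> N" "B c p \<noteq> 0" by blast
    define N' where "N' = N - {p}"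
    have N': "finite N'" "p \<notin> N'" "N = insert p N'" "c < card N'"
      using Suc.prems p by (auto simp: N'_def card_Diff_singleton)
    obtain v where v: "\<exists>i\<in>N'. v i \<noteq> 0"
        "\<forall>r<c. (\<Sum>i\<in>N'. v i * (B c p * B r i - B r p * B c i)) = 0"
      using Suc.IH[of N' "\<lambda>r i. B c p * B r i - B r p * B c i"] N' by auto
    define w where "w i = (if i = p then - (\<Sum>i\<in>N'. v i * B c i) else B c p * v i)" for i
    have w: "(\<Sum>i\<in>N. w i * B r i) =
        (\<Sum>i\<in>N'. B c p * v i * B r i) - (\<Sum>i\<in>N'. v i * B c i) * B r p" for r
    proof -
      have "(\<Sum>i\<in>N'. w i * B r i) = (\<Sum>i\<in>N'. B c p * v i * B r i)"
        by (rule sum.cong) (use N' in \<open>auto simp: w_def\<close>)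
      then show ?thesis using N' by (simp add: w_def)
    qed
    have "(\<Sum>i\<in>N. w i * B r i) = 0" if "r < Suc c" for r
    proof (cases "r = c")
      case True
      then show ?thesis by (simp add: w sum_distrib_left sum_distrib_right algebra_simps)
    next
      case False
      then have "(\<Sum>i\<in>N'. v i * (B c p * B r i - B r p * B c i)) = 0" using v that by simp
      then show ?thesis
        by (simp add: w sum_distrib_left sum_distrib_right algebra_simps sum_subtractf)
    qed
    moreover have "\<exists>i\<in>N. w i \<noteq> 0"
      using v(1) p N' by (auto simp: w_def)
    ultimately show ?thesis by blast
  qed
qed

text \<open>Each of \<open>m\<close> systems of \<open>k\<close> equations has a kernel of rank at least \<open>n - k \<ge> m\<close>, so independent
  vectors can be picked, one from each kernel. Independence is recorded in echelon form: the \<open>i\<close>-th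
  vector is asked to vanish at the \<open>i\<close> pivots chosen before, which makes \<open>k + i < n\<close> equations in all,
  and its own pivot is any coordinate where it does not vanish, made positive by a change of sign.\<close>
lemma triangular_kernel_vectors:
  fixes B :: "nat \<Rightarrow> nat \<Rightarrow> nat \<Rightarrow> int"
  assumes "m + k \<le> n"
  shows "\<exists>\<alpha> p. \<forall>i<m. (\<forall>r<k. (\<Sum>l<n. \<alpha> i l * B i r l) = 0) \<and> p i < n \<and> 0 < \<alpha> i (p i) \<and>
            (\<forall>j<i. \<alpha> i (p j) = 0)"
  using assms
proof (induction m)
  case 0
  then show ?case by auto
next
  case (Suc m)
  then obtain \<alpha> p where *: "\<forall>i<m. (\<forall>r<k. (\<Sum>l<n. \<alpha> i l * B i r l) = 0) \<and> p i < n \<and>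
      0 < \<alpha> i (p i) \<and> (\<forall>j<i. \<alpha> i (p j) = 0)" by auto
  obtain v q where q: "q < n" "v q \<noteq> 0"
    and v: "\<forall>r<m+k. (\<Sum>l<n. v l * (if r < m then (if l = p r then 1 else 0) else B m (r - m) l)) = 0"
    using homogeneous_integer_solution[of "{..<n}" "m + k"
        "\<lambda>r l. if r < m then (if l = p r then 1 else 0) else B m (r - m) l"] Suc.prems
    by auto
  define w where "w l = sgn (v q) * v l" for l
  have "v (p j) = 0" if "j < m" for j
  proof -
    have "(\<Sum>l<n. v l * (if l = p j then 1 else 0)) = 0"
      using v[rule_format, of j] that by simp
    moreover have "(\<Sum>l<n. v l * (if l = p j then 1 else 0)) = (\<Sum>l<n. if l = p j then v l else 0)"
      by (rule sum.cong) auto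
    ultimately show ?thesis using * that by simp
  qed
  moreover have "(\<Sum>l<n. v l * B m r l) = 0" if "r < k" for r
    using v[rule_format, of "m + r"] that by simp
  then have "(\<Sum>l<n. w l * B m r l) = 0" if "r < k" for r
    using that by (simp add: w_def mult.assoc sum_distrib_left[symmetric])
  moreover have "0 < w q" using q by (simp add: w_def sgn_if)
  ultimately show ?case
    using * q by (intro exI[of _ "\<alpha>(m := w)"] exI[of _ "p(m := q)"]) (auto simp: less_Suc_eq w_def)
qed

section \<open>Logarithms of homotopies of circle-valued maps\<close>

text \<open>By uniform continuity a homotopy into the circle can be cut into \<open>N\<close> time steps, during each of
  which no point moves to its antipode. The angle of each step is then given by the principal
  argument, away from its branch cut, and the sum of the \<open>N\<close> angles is continuous.\<close>
lemma circle_homotopy_log: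
  fixes v :: "'a::metric_space \<Rightarrow> real \<Rightarrow> complex"
  assumes X: "compact X" and cont: "continuous_on (X \<times> {0..1}) (\<lambda>(x, t). v x t)"
    and norm: "\<And>x t. x \<in> X \<Longrightarrow> t \<in> {0..1} \<Longrightarrow> norm (v x t) = 1"
  obtains h where "continuous_on X h" "\<And>x. x \<in> X \<Longrightarrow> v x 1 = v x 0 * cis (h x)"
proof -
  have "uniformly_continuous_on (X \<times> {0..1}) (\<lambda>(x, t). v x t)"
    by (intro compact_uniformly_continuous cont compact_Times X) auto
  then obtain d where "d > 0"
    and d': "\<forall>x\<in>X \<times> {0..1}. \<forall>x'\<in>X \<times> {0..1}. dist x' x < d \<longrightarrow>
       dist ((\<lambda>(x, t). v x t) x') ((\<lambda>(x, t). v x t) x) < 2"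
    unfolding uniformly_continuous_on_def by (meson zero_less_numeral)
  have d: "dist (v x t) (v x' t') < 2"
    if "x \<in> X" "x' \<in> X" "t \<in> {0..1}" "t' \<in> {0..1}" "dist (x, t) (x', t') < d"
    for x t x' t' using d'[rule_format, of "(x', t')" "(x, t)"] that by simp
  obtain N0 where N0: "inverse (of_nat (Suc N0)) < d"
    using reals_Archimedean[OF \<open>d > 0\<close>] by auto
  define N where "N = Suc N0"
  define w where "w i x = v x (real (Suc i) / real N) / v x (real i / real N)" for i x
  have I: "real i / real N \<in> {0..1}" if "i \<le> N" for i
    using that by (auto simp: divide_le_eq N_def)
  have w: "norm (w i x) = 1" "w i x \<notin> \<real>\<^sub>\<le>\<^sub>0" if "i < N" "x \<in> X" for i x
  proof -
    let ?a = "v x (real i / real N)" and ?b = "v x (real (Suc i) / real N)"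
    have n: "norm ?a = 1" "norm ?b = 1"
      using that I[of i] I[of "Suc i"] norm by auto
    then show nw: "norm (w i x) = 1" by (simp add: w_def norm_divide)
    have "dist (real i / real N) (real (Suc i) / real N) < d"
      using N0 by (simp add: dist_real_def N_def diff_divide_distrib[symmetric] inverse_eq_divide)
    then have "dist ?a ?b < 2"
      using that I[of i] I[of "Suc i"] by (intro d) (auto simp: dist_Pair_Pair)
    moreover have "?b = w i x * ?a" using n by (auto simp: w_def)
    ultimately have "w i x \<noteq> -1"
      using n by (auto simp: dist_norm simp flip: mult_2)
    show "w i x \<notin> \<real>\<^sub>\<le>\<^sub>0"
    proof
      assume "w i x \<in> \<real>\<^sub>\<le>\<^sub>0"
      then obtain r where "w i x = of_real r" "r \<le> 0" by (auto elim!: nonpos_Reals_cases)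
      with nw have "w i x = -1" by simp
      with \<open>w i x \<noteq> -1\<close> show False ..
    qed
  qed
  have contv: "continuous_on X (\<lambda>x. v x t)" if "t \<in> {0..1}" for t
    using continuous_on_compose2[OF cont, of X "\<lambda>x. (x, t)",
        OF continuous_on_Pair[OF continuous_on_id continuous_on_const]] that
    by (simp add: image_subset_iff)
  define h where "h x = (\<Sum>i<N. Arg (w i x))" for x
  have "continuous_on X h"
    unfolding h_def
  proof (intro continuous_on_sum continuous_on_Arg')
    fix i assume "i \<in> {..<N}"
    then have "i \<le> N" "Suc i \<le> N"
      by auto
    note i = I[OF this(1)] I[OF this(2)]
    have "\<forall>x\<in>X. v x (real i / real N) \<noteq> 0"
      using norm[OF _ i(1)] by (metis norm_zero zero_neq_one)
    then show "continuous_on X (w i)"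
      unfolding w_def by (intro continuous_on_divide contv i)
  qed (use w in auto)
  moreover have "v x 1 = v x 0 * cis (h x)" if "x \<in> X" for x
  proof -
    have "v x (real M / real N) = v x 0 * cis (\<Sum>i<M. Arg (w i x))" if "M \<le> N" for M
      using that
    proof (induction M)
      case (Suc M)
      have "v x (real M / real N) \<noteq> 0" using norm[OF \<open>x \<in> X\<close> I[of M]] Suc.prems by auto
      then have "v x (real (Suc M) / real N) = v x (real M / real N) * w M x" by (simp add: w_def)
      also have "w M x = cis (Arg (w M x))"
        using w(1)[of M x] Suc.prems \<open>x \<in> X\<close> by (subst cis_Arg) (auto simp: sgn_eq)
      finally show ?case using Suc by (simp add: cis_mult[symmetric] mult.assoc)
    qed simp
    from this[of N] show ?thesis by (simp add: h_def N_def)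
  qed
  ultimately show ?thesis by (rule that)
qed

section \<open>Circle-valued maps on the torus\<close>
abbreviation circle_power :: "nat \<Rightarrow> (nat \<Rightarrow> complex) set" where
  "circle_power n \<equiv> PiE {..<n} (\<lambda>_. sphere 0 1)"

text \<open>An extensional function is pinned to \<open>undefined\<close> outside the index set, and a factor with a single
  point does not change a product; so the torus is a subspace of the full function space, where
  compactness and continuity arguments for metric spaces apply.\<close>
lemma torus_eq_top_of_set: "torus n = top_of_set (circle_power n)"
proof -
  define S where "S i = (if i < n then sphere 0 1 else {undefined :: complex})" for i
  have eq: "circle_power n = PiE UNIV S"
    unfolding PiE_def Pi_def extensional_def S_def by (auto split: if_splits)
  have "top_of_set (circle_power n) = product_topology (\<lambda>i. top_of_set (S i)) UNIV"
    using subtopology_product_topology[of "\<lambda>_. euclidean" UNIV S]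
    unfolding eq euclidean_product_topology .
  moreover have "continuous_map (torus n) (top_of_set (S i)) (\<lambda>x. x i)" for i
  proof (cases "i < n")
    case True
    then show ?thesis
      unfolding torus_def S_def by (auto intro!: continuous_map_product_projection)
  next
    case False
    have "continuous_map (torus n) (top_of_set (S i)) (\<lambda>_. undefined)"
      using False by (simp add: S_def)
    then show ?thesis
      by (rule continuous_map_eq) (use False in \<open>auto simp: torus_def PiE_def extensional_def\<close>)
  qed
  then have "continuous_map (torus n) (product_topology (\<lambda>i. top_of_set (S i)) UNIV) (\<lambda>x. x)"
    by (simp add: continuous_map_componentwise_UNIV)
  ultimately have 1: "continuous_map (torus n) (top_of_set (circle_power n)) (\<lambda>x. x)"
    by simp
  have 2: "continuous_map (top_of_set (circle_power n)) (torus n) (\<lambda>x. x)"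
    unfolding torus_def continuous_map_componentwise
  proof (intro conjI ballI)
    fix i assume "i \<in> {..<n}"
    moreover have "continuous_on (circle_power n) (\<lambda>x. x i)"
      by (rule continuous_on_eval)
    ultimately show "continuous_map (top_of_set (circle_power n)) (top_of_set (sphere 0 1)) (\<lambda>x. x i)"
      by (simp add: continuous_map_in_subtopology PiE_iff)
  qed (auto simp: PiE_def)
  show ?thesis
    unfolding topology_eq
  proof (intro allI iffI)
    fix U assume U: "openin (torus n) U"
    then have "{x \<in> topspace (top_of_set (circle_power n)). x \<in> U} = U"
      using openin_subset[OF U] by (auto simp: torus_def)
    then show "openin (top_of_set (circle_power n)) U"
      using openin_continuous_map_preimage[OF 2 U] by simp
  next
    fix U assume U: "openin (top_of_set (circle_power n)) U"
    then have "{x \<in> topspace (torus n). x \<in> U} = U"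
      using openin_subset[OF U] by (auto simp: torus_def)
    then show "openin (torus n) U"
      using openin_continuous_map_preimage[OF 1 U] by simp
  qed
qed

lemma subtopology_torus: "A \<subseteq> circle_power n \<Longrightarrow> subtopology (torus n) A = top_of_set A"
  by (simp add: torus_eq_top_of_set subtopology_subtopology inf.absorb2)

lemma compact_circle_power: "compact (circle_power n)"
proof -
  have "compactin (torus n) (topspace (torus n))"
    unfolding compact_space_def[symmetric] torus_def
    by (simp add: compact_space_product_topology compact_space_subtopology)
  then show ?thesis
    unfolding torus_eq_top_of_set by (simp add: compactin_subtopology)
qed

lemma cis_sum: "cis (\<Sum>i\<in>A. f i) = (\<Prod>i\<in>A. cis (f i))"
  by (induction A rule: infinite_finite_induct) (simp_all add: cis_mult[symmetric])

lemma power_int_sum: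
  fixes x :: "'a::field"
  assumes "x \<noteq> 0"
  shows "x powi (\<Sum>i\<in>A. f i) = (\<Prod>i\<in>A. x powi f i)"
  by (induction A rule: infinite_finite_induct) (simp_all add: power_int_add assms)

lemma prod_power_int: "(\<Prod>i\<in>A. f i :: 'a::field) powi n = (\<Prod>i\<in>A. f i powi n)"
  by (induction A rule: infinite_finite_induct) (simp_all add: power_int_mult_distrib)

lemma norm_one_imp_cis: "norm z = 1 \<Longrightarrow> \<exists>\<theta>. z = cis \<theta>"
  by (rule exI[of _ "Arg z"], subst cis_Arg) (auto simp: sgn_eq)

lemma cis_eq_iff: "cis x = cis y \<longleftrightarrow> (\<exists>n::int. x = y + 2 * pi * n)"
proof -
  have "cis x = cis y \<longleftrightarrow> (\<exists>n::int. \<i> * of_real x = \<i> * of_real y + (of_int (2 * n) * pi) * \<i>)"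
    unfolding cis_conv_exp exp_eq ..
  also have "\<dots> \<longleftrightarrow> (\<exists>n::int. x = y + 2 * pi * n)"
    by (simp add: complex_eq_iff algebra_simps)
  finally show ?thesis .
qed

text \<open>Distinct values of \<open>d\<close> are at least \<open>2 * pi\<close> apart, which a connected domain does not allow.\<close>
lemma continuous_integer_multiple_const:
  fixes d :: "real \<Rightarrow> real"
  assumes "continuous_on {0..1} d" "\<And>t. t \<in> {0..1} \<Longrightarrow> \<exists>n::int. d t = 2 * pi * n"
  shows "d 1 = d 0"
proof -
  have "d constant_on {0..1}"
  proof (rule continuous_discrete_range_constant[OF _ assms(1)])
    fix x :: real assume "x \<in> {0..1}"
    show "\<exists>e>0. \<forall>y. y \<in> {0..1} \<and> d y \<noteq> d x \<longrightarrow> e \<le> norm (d y - d x)"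
    proof (intro exI[of _ "2 * pi"] conjI allI impI)
      fix y assume y: "y \<in> {0..1} \<and> d y \<noteq> d x"
      obtain a b :: int where ab: "d x = 2 * pi * a" "d y = 2 * pi * b"
        using assms(2) y \<open>x \<in> _\<close> by metis
      have "1 \<le> \<bar>b - a\<bar>" using y ab by auto
      then have "1 \<le> \<bar>real_of_int b - a\<bar>" by linarith
      then have "2 * pi * 1 \<le> 2 * pi * \<bar>real_of_int b - a\<bar>" by (intro mult_left_mono) auto
      also have "\<dots> = norm (d y - d x)"
        by (simp add: ab right_diff_distrib[symmetric] abs_mult)
      finally show "2 * pi \<le> norm (d y - d x)" by simp
    qed auto
  qed auto
  then show ?thesis by (auto simp: constant_on_def)
qed

text \<open>This is \<open>H\<^sup>1(T\<^sup>k) = \<int>\<^sup>k\<close> in concrete form: a circle-valued map is a monomial, with the winding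
  numbers as exponents, times the exponential of a real function. Pulled back to the cube, the map is
  null-homotopic by radial contraction and hence has a logarithm \<open>H\<close>. On opposite faces of the cube
  \<open>H\<close> differs by a multiple of \<open>2 * pi\<close>, constant by connectedness, which is the winding number.
  Subtracting the corresponding linear function leaves a function that respects the identification
  of opposite faces and so descends to the torus.\<close>
lemma circle_map_on_torus:
  assumes cont: "continuous_on (circle_power k) u" and norm: "\<And>t. t \<in> circle_power k \<Longrightarrow> norm (u t) = 1"
  obtains b :: "nat \<Rightarrow> int" and h where "continuous_on (circle_power k) h"
    "\<And>t. t \<in> circle_power k \<Longrightarrow> u t = cis (h t) * (\<Prod>r<k. t r powi b r)"
proof -
  define I where "I = nat_box k (\<lambda>_. 0) (\<lambda>_. 1)"
  define q where "q s = (\<lambda>j\<in>{..<k}. cis (2 * pi * s j))" for s :: "nat \<Rightarrow> real"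
  have I: "s \<in> I \<longleftrightarrow> (\<forall>j. 0 \<le> s j \<and> s j \<le> 1 \<and> (j \<ge> k \<longrightarrow> s j = 0))" for s
    unfolding I_def nat_box_def mem_Collect_eq
    by (intro all_cong1) auto
  have qT: "q s \<in> circle_power k" for s by (auto simp: q_def)
  have contq: "continuous_on S (\<lambda>x. q (f x))" if "\<And>j. continuous_on S (\<lambda>x. f x j)" for S :: "'a::topological_space set" and f
  proof (rule continuous_on_coordinatewise_then_product)
    show "continuous_on S (\<lambda>x. q (f x) j)" for j
      by (cases "j < k") (auto simp: q_def intro!: continuous_intros that)
  qed
  have contu: "continuous_on S (\<lambda>x. u (q (f x)))" if "\<And>j. continuous_on S (\<lambda>x. f x j)" for S :: "'a::topological_space set" and f
    using qT by (intro continuous_on_compose2[OF cont contq] that) auto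
  obtain H where contH: "continuous_on I H"
    and H: "\<And>s. s \<in> I \<Longrightarrow> u (q (\<lambda>j. 1 * s j)) = u (q (\<lambda>j. 0 * s j)) * cis (H s)"
  proof (rule circle_homotopy_log[of I "\<lambda>s t. u (q (\<lambda>j. t * s j))"])
    show "compact I" by (simp add: I_def compact_nat_box)
    show "continuous_on (I \<times> {0..1}) (\<lambda>(s, t). u (q (\<lambda>j. t * s j)))"
      unfolding case_prod_unfold
      by (intro contu continuous_intros continuous_on_product_then_coordinatewise)
  qed (use qT norm in auto)
  obtain c where c: "u (q (\<lambda>_. 0)) = cis c" using norm_one_imp_cis norm qT by metis
  have H: "u (q s) = cis (c + H s)" if "s \<in> I" for s
    using H[OF that] c by (simp add: cis_mult)
  have scale: "(\<lambda>j. t * s j)(r := x) \<in> I" if "s \<in> I" "t \<in> {0..1}" "x \<in> {0..1}" "r < k" for s t r x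
    using that by (auto simp: I intro: mult_le_one)
  define D where "D r s = H (s(r := 1)) - H (s(r := 0))" for r s
  have D_int: "\<exists>n::int. D r s = 2 * pi * n" if "s \<in> I" "r < k" for r s
  proof -
    have "q (s(r := 1)) = q (s(r := 0))" by (auto simp: q_def)
    moreover have "s(r := 1) \<in> I" "s(r := 0) \<in> I"
      using scale[OF that(1) _ _ that(2), of 1] by simp_all
    ultimately have "cis (c + H (s(r := 1))) = cis (c + H (s(r := 0)))"
      using H by metis
    then show ?thesis unfolding cis_eq_iff D_def by (simp add: algebra_simps)
  qed
  have D_const: "D r s = D r (\<lambda>_. 0)" if "s \<in> I" "r < k" for r s
  proof -
    have "D r (\<lambda>j. 1 * s j) = D r (\<lambda>j. 0 * s j)"
    proof (rule continuous_integer_multiple_const)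
      have "continuous_on {0..1} (\<lambda>t. (\<lambda>j. t * s j)(r := x))" for x
      proof (rule continuous_on_coordinatewise_then_product)
        show "continuous_on {0..1} (\<lambda>t. ((\<lambda>j. t * s j)(r := x)) j)" for j
          by (cases "j = r") (auto intro!: continuous_intros)
      qed
      then show "continuous_on {0..1} (\<lambda>t. D r (\<lambda>j. t * s j))"
        unfolding D_def using that
        by (intro continuous_on_diff continuous_on_compose2[OF contH]) (auto intro!: scale)
      have "(\<lambda>j. t * s j) \<in> I" if "t \<in> {0..1}" for t
        using that \<open>s \<in> I\<close> by (auto simp: I intro: mult_le_one)
      then show "\<exists>n::int. D r (\<lambda>j. t * s j) = 2 * pi * n" if "t \<in> {0..1}" for t
        using that \<open>r < k\<close> D_int by blast
    qed
    then show ?thesis by simp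
  qed
  have "(\<lambda>_. 0) \<in> I" by (simp add: I)
  then obtain b :: "nat \<Rightarrow> int" where b: "\<And>r s. r < k \<Longrightarrow> s \<in> I \<Longrightarrow> D r s = 2 * pi * b r"
    using D_int D_const by metis
  define H' where "H' s = H s - (\<Sum>r<k. 2 * pi * b r * s r)" for s
  have contH': "continuous_on I H'"
    unfolding H'_def
    by (intro continuous_intros contH)
  have H'_upd: "H' (s(r := 0)) = H' s" if "s \<in> I" "s r = 1" "r < k" for s r
  proof -
    have "s(r := 1) = s" using that by auto
    then have "H s - H (s(r := 0)) = 2 * pi * b r"
      using b[OF that(3,1)] by (simp add: D_def)
    moreover have "(\<Sum>j<k. 2 * pi * b j * s j) = 2 * pi * b r * s r + (\<Sum>j\<in>{..<k}-{r}. 2 * pi * b j * s j)"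
      using that by (intro sum.remove) auto
    moreover have "(\<Sum>j<k. 2 * pi * b j * (s(r := 0)) j) = (\<Sum>j\<in>{..<k}-{r}. 2 * pi * b j * s j)"
      using that by (subst sum.remove[of _ r]) auto
    ultimately show ?thesis using that(2) by (simp add: H'_def)
  qed
  \<comment> \<open>Two points of the cube with the same image in the torus agree once each coordinate 1 is replaced
    by 0. The replacement is done one coordinate at a time, because \<open>H'_upd\<close> treats a single face.\<close>
  define z where "z m s = (\<lambda>j. if j < m \<and> s j = 1 then 0 else s j)" for m and s :: "nat \<Rightarrow> real"
  have zI: "z m s \<in> I" if "s \<in> I" for m s using that by (auto simp: I z_def)
  have H'_z: "m \<le> k \<Longrightarrow> H' (z m s) = H' s" if "s \<in> I" for m s
  proof (induction m)
    case 0
    then show ?case by (simp add: z_def)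
  next
    case (Suc m)
    have "z (Suc m) s = (if s m = 1 then (z m s)(m := 0) else z m s)"
      by (auto simp: z_def fun_eq_iff less_Suc_eq)
    moreover have "z m s m = s m" by (simp add: z_def)
    ultimately show ?case using Suc H'_upd[OF zI[OF that], of m m] by auto
  qed
  have fibre: "H' s = H' s'" if "s \<in> I" "s' \<in> I" "q s = q s'" for s s'
  proof -
    have "z k s j = z k s' j" for j
    proof (cases "j < k")
      case True
      have "cis (2 * pi * s j) = cis (2 * pi * s' j)"
        using fun_cong[OF that(3), of j] True by (simp add: q_def)
      moreover have "cis (2 * pi * z k s j) = cis (2 * pi * s j)" for s by (simp add: z_def)
      ultimately have "cis (2 * pi * z k s j) = cis (2 * pi * z k s' j)" by simp
      then obtain n :: int where "2 * pi * z k s j = 2 * pi * z k s' j + 2 * pi * n"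
        unfolding cis_eq_iff by blast
      then have n: "z k s j = z k s' j + n"
        by (simp add: distrib_left[symmetric])
      have "0 \<le> z k s j" "z k s j < 1" "0 \<le> z k s' j" "z k s' j < 1"
        using that(1,2) True by (auto simp: z_def I order.strict_iff_order)
      then have "n = 0" using n by linarith
      with n show ?thesis by simp
    next
      case False
      then show ?thesis using that(1,2) by (simp add: z_def I)
    qed
    then have "z k s = z k s'" ..
    then show ?thesis using H'_z[OF that(1), of k] H'_z[OF that(2), of k] by simp
  qed
  have qI: "q ` I = circle_power k"
  proof (intro equalityI subsetI)
    fix t assume t: "t \<in> circle_power k"
    define s where "s j = (if j < k then Arg2pi (t j) / (2 * pi) else 0)" for j
    have "s \<in> I"
      by (simp add: I s_def Arg2pi_ge_0 less_imp_le[OF Arg2pi_lt_2pi])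
    moreover have "q s = t"
    proof
      fix j
      show "q s j = t j"
      proof (cases "j < k")
        case True
        then have "norm (t j) = 1" using PiE_mem[OF t, of j] by simp
        then show ?thesis using True Arg2pi_eq[of "t j"] by (simp add: q_def s_def cis_conv_exp)
      next
        case False
        then show ?thesis using t by (simp add: q_def PiE_def extensional_def)
      qed
    qed
    ultimately show "t \<in> q ` I" by blast
  qed (use qT in auto)
  define h where "h t = H' (inv_into I q t)" for t
  have hq: "h (q s) = H' s" if "s \<in> I" for s
    unfolding h_def
    by (rule fibre[OF inv_into_into[OF imageI[OF that]] that f_inv_into_f[OF imageI[OF that]]])
  \<comment> \<open>The cube is compact and the torus Hausdorff, so \<open>h\<close> inherits continuity from \<open>H'\<close>.\<close>
  have "quotient_map (top_of_set I) (top_of_set (circle_power k)) q"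
  proof (rule continuous_imp_quotient_map)
    show "continuous_map (top_of_set I) (top_of_set (circle_power k)) q"
      using qT contq[of I "\<lambda>x. x", OF continuous_on_eval]
      by (auto simp: continuous_map_in_subtopology)
    show "compact_space (top_of_set I)"
      using compact_nat_box by (simp add: I_def compact_space_subtopology)
  qed (use qI in \<open>auto simp: Hausdorff_space_subtopology\<close>)
  then have "continuous_map (top_of_set (circle_power k)) euclidean h"
  proof (rule continuous_compose_quotient_map)
    show "continuous_map (top_of_set I) euclidean (h \<circ> q)"
      using contH' hq by (simp cong: continuous_on_cong)
  qed
  then have "continuous_on (circle_power k) (\<lambda>t. c + h t)"
    by (auto intro!: continuous_intros)
  moreover have "u t = cis (c + h t) * (\<Prod>r<k. t r powi b r)" if t: "t \<in> circle_power k" for t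
  proof -
    obtain s where s: "s \<in> I" "t = q s" using t unfolding qI[symmetric] by blast
    have "(\<Prod>r<k. t r powi b r) = cis (\<Sum>r<k. 2 * pi * b r * s r)"
      unfolding cis_sum s by (intro prod.cong) (auto simp: q_def cis_power_int algebra_simps)
    then show ?thesis
      using H[OF s(1)] s hq[OF s(1)] by (simp add: H'_def cis_mult)
  qed
  ultimately show ?thesis by (rule that)
qed

section \<open>The lower bound\<close>

text \<open>The cohomological content of the lower bound. Integer vectors \<open>\<alpha>\<close> stand for classes in \<open>H\<^sup>1(T\<^sup>n)\<close>,
  represented by the monomials with exponents \<open>\<alpha>\<close>, and a class restricts to 0 on \<open>A\<close> exactly if its
  monomial has a continuous logarithm there. If \<open>A\<close> deforms onto a copy of \<open>T\<^sup>k\<close>, then restriction to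
  \<open>A\<close> factors through \<open>H\<^sup>1(T\<^sup>k) = \<int>\<^sup>k\<close>, so all classes satisfying a certain system of \<open>k\<close> linear equations die on \<open>A\<close>. The
  coefficients \<open>B\<close> are the winding numbers of the coordinates of the embedding \<open>\<psi>\<close> of \<open>T\<^sup>k\<close>.\<close>
lemma contractible_within_torus_logs:
  assumes "k \<le> n" "closedin (torus n) A" "contractible_within_to (torus n) (subtorus n k) A"
  obtains B :: "nat \<Rightarrow> nat \<Rightarrow> int" where
    "\<And>\<alpha> :: nat \<Rightarrow> int. (\<And>r. r < k \<Longrightarrow> (\<Sum>l<n. \<alpha> l * B r l) = 0) \<Longrightarrow>
      \<exists>f. continuous_on A f \<and> (\<forall>x\<in>A. (\<Prod>l<n. x l powi \<alpha> l) = cis (f x))"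
proof -
  have AT: "A \<subseteq> circle_power n"
    using closedin_subset[OF assms(2)] by (simp add: torus_eq_top_of_set)
  have compact: "compact A"
    using closedin_compact[OF compact_circle_power] assms(2) by (simp add: torus_eq_top_of_set)
  have subA: "subtopology (torus n) A = top_of_set A"
    by (rule subtopology_torus[OF AT])
  obtain g where hom: "homotopic_with (\<lambda>_. True) (subtopology (torus n) A) (torus n) id g"
    and homeo: "subtopology (torus n) (g ` A) homeomorphic_space subtopology (torus n) (subtorus n k)"
    using assms(3) unfolding contractible_within_to_def by blast
  have "continuous_map (subtopology (torus n) A) (torus n) g"
    using hom by (simp add: homotopic_with_imp_continuous_maps)
  then have contg: "continuous_on A g" and gT: "g ` A \<subseteq> circle_power n"
    unfolding subA by (auto simp: torus_eq_top_of_set continuous_map_in_subtopology)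
  obtain F where contF: "continuous_on ({0..1} \<times> A) F" and FT: "F \<in> {0..1::real} \<times> A \<rightarrow> circle_power n"
    and F0: "\<And>x. F (0, x) = x" and F1: "\<And>x. F (1, x) = g x"
    using hom unfolding homotopic_with_def subA
    by (auto simp: torus_eq_top_of_set continuous_map_in_subtopology)
  have "subtopology (torus n) (g ` A) = top_of_set (g ` A)"
    by (rule subtopology_torus[OF gT])
  then have "top_of_set (g ` A) homeomorphic_space top_of_set (circle_power k)"
    using homeomorphic_space_trans[OF homeo subtorus_homeomorphic_torus[OF assms(1)]]
    by (simp add: torus_eq_top_of_set)
  then obtain \<phi> \<psi> where "homeomorphic_maps (top_of_set (g ` A)) (top_of_set (circle_power k)) \<phi> \<psi>"
    unfolding homeomorphic_space_def by blast
  then have cont\<phi>: "continuous_on (g ` A) \<phi>" and \<phi>T: "\<phi> ` g ` A \<subseteq> circle_power k"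
    and cont\<psi>: "continuous_on (circle_power k) \<psi>" and \<psi>T: "\<psi> ` circle_power k \<subseteq> g ` A"
    and \<psi>\<phi>: "\<And>x. x \<in> A \<Longrightarrow> \<psi> (\<phi> (g x)) = g x"
    unfolding homeomorphic_maps_def by (auto simp: continuous_map_in_subtopology)
  have \<psi>n: "norm (\<psi> t l) = 1" if "t \<in> circle_power k" "l < n" for t l
  proof -
    have "\<psi> t \<in> circle_power n" using that \<psi>T gT by blast
    then show ?thesis using that by (auto simp: PiE_iff)
  qed
  \<comment> \<open>\<open>B l\<close> and \<open>h l\<close> describe the \<open>l\<close>-th coordinate of the embedding, and \<open>\<eta> l\<close> below the angle by which
    the deformation turns the \<open>l\<close>-th coordinate.\<close>
  define Q where "Q l b h \<longleftrightarrow> continuous_on (circle_power k) h \<and>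
      (\<forall>t\<in>circle_power k. \<psi> t l = cis (h t) * (\<Prod>r<k. t r powi b r))"
    for l and b :: "nat \<Rightarrow> int" and h :: "(nat \<Rightarrow> complex) \<Rightarrow> real"
  have "\<exists>b h. Q l b h" if "l < n" for l
    by (rule circle_map_on_torus[of k "\<lambda>t. \<psi> t l"])
       (use that \<psi>n continuous_on_product_then_coordinatewise[OF cont\<psi>] in \<open>auto simp: Q_def\<close>)
  then obtain B h where "\<And>l. l < n \<Longrightarrow> Q l (B l) (h l)"
    by metis
  then have h: "\<And>l. l < n \<Longrightarrow> continuous_on (circle_power k) (h l)"
    and B: "\<And>l t. l < n \<Longrightarrow> t \<in> circle_power k \<Longrightarrow> \<psi> t l = cis (h l t) * (\<Prod>r<k. t r powi B l r)"
    by (simp_all add: Q_def)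
  have "\<exists>\<eta>. continuous_on A \<eta> \<and> (\<forall>x\<in>A. g x l = x l * cis (\<eta> x))" if "l < n" for l
  proof -
    have swap: "continuous_on (A \<times> {0..1}) (\<lambda>(x, t). F (t, x) l)"
    proof -
      have "continuous_on (A \<times> {0..1}) (\<lambda>p. F (snd p, fst p))"
        by (rule continuous_on_compose2[OF contF])
           (auto intro!: continuous_on_Pair continuous_on_fst continuous_on_snd continuous_on_id)
      then show ?thesis
        unfolding case_prod_unfold by (rule continuous_on_product_then_coordinatewise)
    qed
    show ?thesis
    proof (rule circle_homotopy_log[OF compact swap])
      fix x t assume "x \<in> A" "t \<in> {0..1::real}"
      then have "F (t, x) \<in> circle_power n" using FT by blast
      then show "norm (F (t, x) l) = 1" using that by (auto simp: PiE_iff)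
    qed (auto simp: F0 F1)
  qed
  then obtain \<eta> where \<eta>: "\<And>l. l < n \<Longrightarrow> continuous_on A (\<eta> l)"
    and g\<eta>: "\<And>l x. l < n \<Longrightarrow> x \<in> A \<Longrightarrow> g x l = x l * cis (\<eta> l x)"
    by metis
  show ?thesis
  proof (rule that[of "\<lambda>r l. B l r"])
    fix \<alpha> :: "nat \<Rightarrow> int" assume \<alpha>: "\<And>r. r < k \<Longrightarrow> (\<Sum>l<n. \<alpha> l * B l r) = 0"
    define f where "f x = (\<Sum>l<n. \<alpha> l * (h l (\<phi> (g x)) - \<eta> l x))" for x
    have "continuous_on A f"
    proof -
      have "continuous_on A (\<lambda>x. h l (\<phi> (g x)))" if "l < n" for l
        using \<phi>T by (intro continuous_on_compose2[OF h[OF that]]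
            continuous_on_compose2[OF cont\<phi>] contg) auto
      then show ?thesis
        unfolding f_def by (auto intro!: continuous_intros \<eta>)
    qed
    moreover have "(\<Prod>l<n. x l powi \<alpha> l) = cis (f x)" if "x \<in> A" for x
    proof -
      define t where "t = \<phi> (g x)"
      have t: "t \<in> circle_power k" using \<phi>T that by (auto simp: t_def)
      have tn: "t r \<noteq> 0" if "r < k" for r using PiE_mem[OF t, of r] that by auto
      have x: "x l = cis (h l t - \<eta> l x) * (\<Prod>r<k. t r powi B l r)" if "l < n" for l
      proof -
        have "x l * cis (\<eta> l x) = cis (h l t) * (\<Prod>r<k. t r powi B l r)"
          using g\<eta>[OF that \<open>x \<in> A\<close>] B[OF that t] \<psi>\<phi>[OF \<open>x \<in> A\<close>] by (simp add: t_def)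
        then have "x l * cis (\<eta> l x) * cis (- \<eta> l x) =
            cis (h l t) * cis (- \<eta> l x) * (\<Prod>r<k. t r powi B l r)"
          by simp
        then show ?thesis by (simp add: cis_mult mult.assoc)
      qed
      have "(\<Prod>l<n. x l powi \<alpha> l) =
          (\<Prod>l<n. cis (\<alpha> l * (h l t - \<eta> l x)) * (\<Prod>r<k. t r powi (\<alpha> l * B l r)))"
      proof (rule prod.cong)
        fix l assume "l \<in> {..<n}"
        then have "x l powi \<alpha> l = cis (h l t - \<eta> l x) powi \<alpha> l * (\<Prod>r<k. t r powi B l r) powi \<alpha> l"
          using x by (simp add: power_int_mult_distrib)
        then show "x l powi \<alpha> l = cis (\<alpha> l * (h l t - \<eta> l x)) * (\<Prod>r<k. t r powi (\<alpha> l * B l r))"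
          by (simp add: cis_power_int prod_power_int power_int_mult mult.commute[of "\<alpha> l"])
      qed simp
      also have "\<dots> = cis (f x) * (\<Prod>r<k. \<Prod>l<n. t r powi (\<alpha> l * B l r))"
        by (simp add: prod.distrib f_def cis_sum t_def) (rule prod.swap)
      also have "(\<Prod>r<k. \<Prod>l<n. t r powi (\<alpha> l * B l r)) = 1"
      proof (rule prod.neutral, rule ballI)
        fix r assume "r \<in> {..<k}"
        then have "t r \<noteq> 0" "(\<Sum>l<n. \<alpha> l * B l r) = 0" using tn \<alpha> by auto
        then have "(\<Prod>l<n. t r powi (\<alpha> l * B l r)) = t r powi (\<Sum>l<n. \<alpha> l * B l r)"
          by (intro power_int_sum[symmetric])
        then show "(\<Prod>l<n. t r powi (\<alpha> l * B l r)) = 1"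
          using \<open>(\<Sum>l<n. \<alpha> l * B l r) = 0\<close> by simp
      qed
      finally show ?thesis by simp
    qed
    ultimately show "\<exists>f. continuous_on A f \<and> (\<forall>x\<in>A. (\<Prod>l<n. x l powi \<alpha> l) = cis (f x))"
      by blast
  qed
qed

text \<open>The side lengths \<open>(N + 1) ^ (m - Suc i)\<close> grow fast enough for each to outweigh \<open>N\<close> times the sum of
  all later ones; \<open>triangular_bounded_system\<close> needs this.\<close>
lemma geometric_box:
  fixes N :: real
  assumes "i < m"
  shows "(N + 1) ^ (m - Suc i) = 1 + N * (\<Sum>j\<in>{i<..<m}. (N + 1) ^ (m - Suc j))"
proof -
  have "(\<Sum>j\<in>{i<..<m}. (N + 1) ^ (m - Suc j)) = (\<Sum>l<m - Suc i. (N + 1) ^ l)"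
    by (rule sum.reindex_bij_witness[of _ "\<lambda>l. m - Suc l" "\<lambda>j. m - Suc j"]) (use assms in auto)
  then show ?thesis
    using power_diff_1_eq[of "N + 1" "m - Suc i"] by (simp add: algebra_simps)
qed

text \<open>A bounded perturbation of an invertible linear map is still onto. The matrix being triangular, the
  box for \<open>poincare_miranda\<close> can be written down: its sides increase geometrically from the last
  coordinate to the first, so that on the faces \<open>s i = R i\<close> and \<open>s i = - R i\<close> the diagonal term decides
  the sign of the \<open>i\<close>-th equation.\<close>
lemma triangular_bounded_system:
  fixes a :: "nat \<Rightarrow> nat \<Rightarrow> int" and f :: "nat \<Rightarrow> (nat \<Rightarrow> real) \<Rightarrow> real"
  assumes diag: "\<And>i. i < m \<Longrightarrow> 0 < a i i" and tri: "\<And>i j. i < m \<Longrightarrow> j < i \<Longrightarrow> a i j = 0"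
    and cont: "\<And>i. i < m \<Longrightarrow> continuous_on UNIV (f i)"
    and bdd: "\<And>i s. i < m \<Longrightarrow> \<bar>f i s\<bar> \<le> C"
  obtains s :: "nat \<Rightarrow> real" where "\<And>i. i < m \<Longrightarrow> (\<Sum>j<m. a i j * s j) = f i s"
proof (cases "m = 0")
  case True
  then show ?thesis using that by simp
next
  case False
  then have "0 \<le> C" using bdd[of 0] abs_ge_zero order_trans by blast
  define N where "N = (\<Sum>i<m. \<Sum>j<m. \<bar>real_of_int (a i j)\<bar>)"
  have N0: "0 \<le> N" by (simp add: N_def sum_nonneg)
  have N: "\<bar>real_of_int (a i j)\<bar> \<le> N" if "i < m" "j < m" for i j
  proof -
    have "\<bar>real_of_int (a i j)\<bar> \<le> (\<Sum>j<m. \<bar>real_of_int (a i j)\<bar>)"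
      using that by (intro member_le_sum) auto
    also have "\<dots> \<le> N"
      unfolding N_def using that by (intro member_le_sum[of i _ "\<lambda>i. \<Sum>j<m. \<bar>real_of_int (a i j)\<bar>"]) (auto intro: sum_nonneg)
    finally show ?thesis .
  qed
  define R where "R j = C * (N + 1) ^ (m - Suc j)" for j
  have R0: "0 \<le> R j" for j using N0 \<open>0 \<le> C\<close> by (simp add: R_def)
  have dominate: "\<bar>(\<Sum>j\<in>{..<m}-{i}. a i j * s j) - f i s\<bar> \<le> R i"
    if "i < m" and box: "s \<in> nat_box m (\<lambda>j. - R j) R" for i and s :: "nat \<Rightarrow> real"
  proof -
    have s: "\<bar>s j\<bar> \<le> R j" if "j < m" for j
      using box that by (auto simp: nat_box_def abs_le_iff dest!: spec[of _ j])
    have "(\<Sum>j\<in>{..<m}-{i}. a i j * s j) = (\<Sum>j\<in>{i<..<m}. a i j * s j)"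
      using tri[OF \<open>i < m\<close>] by (intro sum.mono_neutral_right) (auto simp: not_less)
    moreover have "\<bar>\<Sum>j\<in>{i<..<m}. a i j * s j\<bar> \<le> (\<Sum>j\<in>{i<..<m}. N * R j)"
    proof (rule sum_abs[THEN order_trans], rule sum_mono)
      fix j assume "j \<in> {i<..<m}"
      then show "\<bar>a i j * s j\<bar> \<le> N * R j"
        unfolding abs_mult using N[OF \<open>i < m\<close>] s N0 by (intro mult_mono) auto
    qed
    moreover have "(\<Sum>j\<in>{i<..<m}. N * R j) + C = R i"
      using geometric_box[OF \<open>i < m\<close>, of N] by (simp add: R_def sum_distrib_left algebra_simps)
    ultimately show ?thesis using bdd[OF \<open>i < m\<close>, of s] by linarith
  qed
  have split: "(\<Sum>j<m. a i j * s j) - f i s = a i i * s i + ((\<Sum>j\<in>{..<m}-{i}. a i j * s j) - f i s)"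
    if "i < m" for i and s :: "nat \<Rightarrow> real"
    using that by (subst sum.remove[of _ i]) auto
  have diagR: "R i \<le> a i i * R i" if "i < m" for i
    using mult_right_mono[OF _ R0, of 1 "a i i" i] diag[OF that] by simp
  obtain s :: "nat \<Rightarrow> real" where s: "\<And>i. i < m \<Longrightarrow> (\<Sum>j<m. a i j * s j) - f i s = 0"
  proof (rule poincare_miranda[of m "\<lambda>j. - R j" R "\<lambda>i s. (\<Sum>j<m. a i j * s j) - f i s"])
    show "continuous_on (nat_box m (\<lambda>j. - R j) R) (\<lambda>s. (\<Sum>j<m. a i j * s j) - f i s)" if "i < m" for i
      using continuous_on_subset[OF cont[OF that]]
      by (intro continuous_intros) auto
    show "(\<Sum>j<m. a i j * s j) - f i s \<le> 0"
      if "i < m" "s \<in> nat_box m (\<lambda>j. - R j) R" "s i = - R i" for i and s :: "nat \<Rightarrow> real"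
      using dominate[OF that(1,2)] diagR[OF that(1)] that(3) unfolding split[OF that(1)] by simp
    show "0 \<le> (\<Sum>j<m. a i j * s j) - f i s"
      if "i < m" "s \<in> nat_box m (\<lambda>j. - R j) R" "s i = R i" for i and s :: "nat \<Rightarrow> real"
      using dominate[OF that(1,2)] diagR[OF that(1)] that(3) unfolding split[OF that(1)] by simp
  qed (use R0 in \<open>auto simp: minus_le_iff\<close>)
  show ?thesis by (rule that[of s]) (use s in simp)
qed

text \<open>The cup-length argument, with the nonvanishing of a product of \<open>m\<close> independent classes replaced by
  surjectivity. Suppose \<open>m + k \<le> n\<close>. Choose independent classes \<open>\<alpha> i\<close> dying on \<open>A i\<close>, with logarithms
  \<open>f i\<close> extended to the whole torus by Tietze's theorem. On the subtorus spanned by the pivot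
  coordinates, with angles \<open>s\<close>, the \<open>\<alpha> i\<close> are the rows of a triangular matrix; hence some \<open>s\<close> makes the
  angle of the \<open>i\<close>-th monomial differ from \<open>f i\<close> by exactly \<open>pi\<close> for every \<open>i\<close>. The corresponding point
  lies in none of the \<open>A i\<close>.\<close>
lemma contractible_cover_card_ge:
  assumes "k \<le> n"
    and A: "\<And>i. i < m \<Longrightarrow> closedin (torus n) (A i)"
      "\<And>i. i < m \<Longrightarrow> contractible_within_to (torus n) (subtorus n k) (A i)"
    and cover: "topspace (torus n) = (\<Union>i<m. A i)"
  shows "n < m + k"
proof (rule ccontr)
  assume "\<not> n < m + k"
  then have mkn: "m + k \<le> n" by simp
  have "\<exists>B :: nat \<Rightarrow> nat \<Rightarrow> int. \<forall>\<alpha> :: nat \<Rightarrow> int. (\<forall>r<k. (\<Sum>l<n. \<alpha> l * B r l) = 0) \<longrightarrow>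
      (\<exists>f. continuous_on (A i) f \<and> (\<forall>x\<in>A i. (\<Prod>l<n. x l powi \<alpha> l) = cis (f x)))" if "i < m" for i
    by (rule contractible_within_torus_logs[OF \<open>k \<le> n\<close> A[OF that]]) blast
  then obtain B :: "nat \<Rightarrow> nat \<Rightarrow> nat \<Rightarrow> int" where
    B: "\<And>i \<alpha>. i < m \<Longrightarrow> \<forall>r<k. (\<Sum>l<n. \<alpha> l * B i r l) = 0 \<Longrightarrow>
      \<exists>f. continuous_on (A i) f \<and> (\<forall>x\<in>A i. (\<Prod>l<n. x l powi \<alpha> l) = cis (f x))"
    by metis
  obtain \<alpha> p where \<alpha>: "\<forall>i<m. (\<forall>r<k. (\<Sum>l<n. \<alpha> i l * B i r l) = 0) \<and> p i < n \<and> 0 < \<alpha> i (p i) \<and>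
            (\<forall>j<i. \<alpha> i (p j) = 0)"
    using triangular_kernel_vectors[OF mkn, of B] by blast
  define Q where "Q i f c \<longleftrightarrow> continuous_on (circle_power n) f \<and>
      (\<forall>x\<in>circle_power n. \<bar>f x\<bar> \<le> c) \<and> (\<forall>x\<in>A i. (\<Prod>l<n. x l powi \<alpha> i l) = cis (f x))"
    for i f and c :: real
  have "\<exists>f c. Q i f c" if i: "i < m" for i
  proof -
    obtain f where f: "continuous_on (A i) f" "\<forall>x\<in>A i. (\<Prod>l<n. x l powi \<alpha> i l) = cis (f x)"
      using B[OF i] \<alpha> i by meson
    have cl: "closedin (top_of_set (circle_power n)) (A i)"
      using A(1)[OF i] by (simp add: torus_eq_top_of_set)
    then have "compact (f ` A i)"
      using closedin_compact[OF compact_circle_power] f(1) by (blast intro: compact_continuous_image)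
    then obtain c where "\<And>x. x \<in> A i \<Longrightarrow> norm (f x) \<le> c" "0 < c"
      using bounded_pos[THEN iffD1, OF compact_imp_bounded] by (metis imageI)
    then obtain g where "continuous_on (circle_power n) g" "\<And>x. x \<in> A i \<Longrightarrow> g x = f x"
        "\<And>x. x \<in> circle_power n \<Longrightarrow> norm (g x) \<le> c"
      using Tietze[OF f(1) cl, of c] by (metis less_imp_le)
    then show ?thesis using f(2) by (intro exI[of _ g] exI[of _ c]) (auto simp: Q_def)
  qed
  then obtain f c where "\<And>i. i < m \<Longrightarrow> Q i (f i) (c i)"
    by metis
  then have f: "\<And>i. i < m \<Longrightarrow> continuous_on (circle_power n) (f i)"
    "\<And>i x. i < m \<Longrightarrow> x \<in> circle_power n \<Longrightarrow> \<bar>f i x\<bar> \<le> c i"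
    "\<And>i x. i < m \<Longrightarrow> x \<in> A i \<Longrightarrow> (\<Prod>l<n. x l powi \<alpha> i l) = cis (f i x)"
    by (simp_all add: Q_def)
  \<comment> \<open>The point with angle \<open>s j\<close> in coordinate \<open>p j\<close> and angle 0 elsewhere; the sum has at most one
    nonzero term, as the pivots are distinct.\<close>
  define x where "x s = (\<lambda>l\<in>{..<n}. cis (\<Sum>j<m. of_bool (p j = l) * s j))" for s :: "nat \<Rightarrow> real"
  have xT: "x s \<in> circle_power n" for s by (auto simp: x_def)
  have contx: "continuous_on UNIV x"
  proof (rule continuous_on_coordinatewise_then_product)
    show "continuous_on UNIV (\<lambda>s. x s l)" for l
      by (cases "l < n")
         (auto simp: x_def intro!: continuous_intros)
  qed
  have chi: "(\<Prod>l<n. x s l powi \<alpha> i l) = cis (\<Sum>j<m. \<alpha> i (p j) * s j)" for i and s :: "nat \<Rightarrow> real"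
  proof -
    have "(\<Prod>l<n. x s l powi \<alpha> i l) = cis (\<Sum>l<n. \<alpha> i l * (\<Sum>j<m. of_bool (p j = l) * s j))"
      unfolding cis_sum[of _ "{..<n}"] by (intro prod.cong) (auto simp: x_def cis_power_int)
    also have "(\<Sum>l<n. \<alpha> i l * (\<Sum>j<m. of_bool (p j = l) * s j)) =
        (\<Sum>j<m. \<Sum>l<n. \<alpha> i l * (of_bool (p j = l) * s j))"
      unfolding sum_distrib_left by (rule sum.swap)
    also have "\<dots> = (\<Sum>j<m. \<alpha> i (p j) * s j)"
    proof (rule sum.cong)
      fix j assume "j \<in> {..<m}"
      have "(\<Sum>l<n. \<alpha> i l * (of_bool (p j = l) * s j)) = (\<Sum>l<n. if p j = l then \<alpha> i l * s j else 0)"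
        by (rule sum.cong) auto
      then show "(\<Sum>l<n. \<alpha> i l * (of_bool (p j = l) * s j)) = \<alpha> i (p j) * s j"
        using \<alpha> \<open>j \<in> _\<close> by simp
    qed simp
    finally show ?thesis .
  qed
  define C where "C = (\<Sum>i<m. \<bar>c i\<bar>) + pi"
  obtain s :: "nat \<Rightarrow> real" where s: "\<And>i. i < m \<Longrightarrow> (\<Sum>j<m. \<alpha> i (p j) * s j) = f i (x s) + pi"
  proof (rule triangular_bounded_system[of m "\<lambda>i j. \<alpha> i (p j)" "\<lambda>i s. f i (x s) + pi" C])
    show "continuous_on UNIV (\<lambda>s. f i (x s) + pi)" if "i < m" for i
      using xT by (intro continuous_intros continuous_on_compose2[OF f(1)[OF that] contx]) auto
    show "\<bar>f i (x s) + pi\<bar> \<le> C" if "i < m" for i s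
    proof -
      have "\<bar>c i\<bar> \<le> (\<Sum>i<m. \<bar>c i\<bar>)" using that by (intro member_le_sum) auto
      then show ?thesis using f(2)[OF that xT, of s] pi_gt_zero unfolding C_def by linarith
    qed
  qed (use \<alpha> in auto)
  obtain i where i: "i < m" "x s \<in> A i"
    using xT[of s] cover by (auto simp: torus_eq_top_of_set)
  have "cis (f i (x s)) = cis (f i (x s) + pi)"
    using f(3)[OF i] chi[of s i] s[OF i(1)] by simp
  also have "\<dots> = - cis (f i (x s))" by (simp add: cis_mult[symmetric])
  finally show False by simp
qed

section \<open>The upper bound\<close>

text \<open>With a full turn as the unit of angle, the circle is cut into \<open>N\<close> arcs of equal length, and \<open>circle_arc N i\<close> is the closed
  complement of the \<open>i\<close>-th of them. The parameter interval starts at the end of the removed arc and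
  runs around the circle to its beginning, so that it is not broken at the base point.\<close>
definition circle_arc :: "nat \<Rightarrow> nat \<Rightarrow> complex set" where
  "circle_arc N i = (\<lambda>\<theta>. cis (2 * pi * \<theta>)) ` {(real i + 1) / N .. real i / N + 1}"

lemma compact_circle_arc: "compact (circle_arc N i)"
  unfolding circle_arc_def by (intro compact_continuous_image continuous_intros) auto

text \<open>The parameter interval is shorter than a full turn, so the parametrisation is a continuous injection
  of a compact set and has a continuous inverse.\<close>
lemma circle_arc_angle:
  assumes "0 < N"
  obtains \<theta> where "continuous_on (circle_arc N i) \<theta>" "\<And>z. z \<in> circle_arc N i \<Longrightarrow> z = cis (\<theta> z)"
proof -
  let ?J = "{(real i + 1) / N .. real i / N + 1}" and ?e = "\<lambda>\<theta>. cis (2 * pi * \<theta>)"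
  have inj: "inj_on ?e ?J"
  proof (rule inj_onI)
    fix x y assume xy: "x \<in> ?J" "y \<in> ?J" "?e x = ?e y"
    then obtain n :: int where "2 * pi * x = 2 * pi * y + 2 * pi * n"
      unfolding cis_eq_iff by blast
    then have n: "x = y + n" by (simp add: distrib_left[symmetric])
    have "real i / N < (real i + 1) / N" using assms by (simp add: divide_strict_right_mono)
    then have "\<bar>x - y\<bar> < 1" using xy(1,2) by auto
    with n show "x = y" by simp
  qed
  have inv: "continuous_on (?e ` ?J) (inv_into ?J ?e)"
    by (rule continuous_on_inv) (auto intro!: continuous_intros simp: inv_into_f_f[OF inj])
  show ?thesis
  proof (rule that[of "\<lambda>z. 2 * pi * inv_into ?J ?e z"])
    show "continuous_on (circle_arc N i) (\<lambda>z. 2 * pi * inv_into ?J ?e z)"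
      unfolding circle_arc_def by (intro continuous_intros inv)
    show "z = cis (2 * pi * inv_into ?J ?e z)" if "z \<in> circle_arc N i" for z
      using that f_inv_into_f[of z ?e ?J] by (simp add: circle_arc_def)
  qed
qed

lemma circle_arc_nonempty: "0 < N \<Longrightarrow> circle_arc N i \<noteq> {}"
  by (auto simp: circle_arc_def field_simps)

text \<open>A point lies in at most one of the \<open>N\<close> removed arcs, and the floor computes the index of the only
  candidate.\<close>
lemma mem_circle_arc:
  assumes "0 < N" "norm z = 1" "i < N" "i \<noteq> nat \<lfloor>N * (Arg2pi z / (2 * pi))\<rfloor>"
  shows "z \<in> circle_arc N i"
proof -
  define \<theta> where "\<theta> = Arg2pi z / (2 * pi)"
  have \<theta>: "0 \<le> \<theta>" "\<theta> < 1" by (simp_all add: \<theta>_def Arg2pi_ge_0 Arg2pi_lt_2pi)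
  have z: "cis (2 * pi * \<theta>) = z"
    using Arg2pi_eq[of z] assms(2) by (simp add: \<theta>_def cis_conv_exp)
  have "i \<noteq> nat \<lfloor>N * \<theta>\<rfloor>" using assms(4) by (simp add: \<theta>_def)
  then consider "real i + 1 \<le> N * \<theta>" | "N * \<theta> < real i"
    using \<theta> by linarith
  then show ?thesis
  proof cases
    case 1
    then have "(real i + 1) / N \<le> \<theta>" using assms(1) by (simp add: divide_le_eq mult.commute)
    moreover have "\<theta> \<le> real i / N + 1" using \<theta> by (simp add: add_increasing)
    ultimately show ?thesis unfolding circle_arc_def using z by force
  next
    case 2
    \<comment> \<open>Here the angle lies before the removed arc and is reached after one more turn.\<close>
    then have "\<theta> < real i / N" using assms(1) by (simp add: less_divide_eq mult.commute)
    moreover have "(real i + 1) / N \<le> 1" using assms(1,3) by (simp add: divide_le_eq)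
    moreover have "cis (2 * pi * (\<theta> + 1)) = z"
      using z by (simp add: distrib_left cis_mult[symmetric])
    ultimately show ?thesis unfolding circle_arc_def using \<theta>
      by (intro image_eqI[of _ _ "\<theta> + 1"]) auto
  qed
qed

text \<open>A proper arc of the circle has a continuous angle, and scaling that angle down to 0 contracts the arc
  to the base point. Doing so in the last \<open>n - k\<close> coordinates sweeps a product of arcs onto the whole
  subtorus.\<close>
lemma contractible_within_to_arc_product:
  assumes "k \<le> n" "0 < N"
  shows "closedin (torus n) {x \<in> circle_power n. \<forall>l\<in>{k..<n}. x l \<in> circle_arc N i}" (is "closedin _ ?A")
    and "contractible_within_to (torus n) (subtorus n k) {x \<in> circle_power n. \<forall>l\<in>{k..<n}. x l \<in> circle_arc N i}"
proof -
  have "closed (circle_arc N i)" by (rule compact_imp_closed[OF compact_circle_arc])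
  then have cl: "closedin (top_of_set (circle_power n)) (circle_power n \<inter> (\<lambda>x. x l) -` circle_arc N i)" for l
    by (intro continuous_closedin_preimage continuous_on_eval)
  have "closedin (top_of_set (circle_power n)) (circle_power n \<inter>
      (\<Inter>l\<in>{k..<n}. circle_power n \<inter> (\<lambda>x. x l) -` circle_arc N i))"
  proof (cases "{k..<n} = {}")
    case False
    then show ?thesis
      by (intro closedin_Int[OF closedin_subtopology_refl[THEN iffD2]] closedin_INT cl) simp_all
  qed simp
  also have "circle_power n \<inter> (\<Inter>l\<in>{k..<n}. circle_power n \<inter> (\<lambda>x. x l) -` circle_arc N i) = ?A"
    by blast
  finally show "closedin (torus n) ?A" by (simp add: torus_eq_top_of_set)
  obtain \<theta> where \<theta>: "continuous_on (circle_arc N i) \<theta>"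
    and cis\<theta>: "\<And>z. z \<in> circle_arc N i \<Longrightarrow> z = cis (\<theta> z)"
    using circle_arc_angle[OF \<open>0 < N\<close>] by blast
  define F where "F t x = (\<lambda>l. if k \<le> l \<and> l < n then cis ((1 - t) * \<theta> (x l)) else x l)"
    for t :: real and x :: "nat \<Rightarrow> complex"
  have FT: "F t x \<in> circle_power n" if "x \<in> circle_power n" for t x
    using that by (auto simp: F_def PiE_iff extensional_def)
  have F0: "F 0 x = x" if "x \<in> ?A" for x
    using that cis\<theta> by (auto simp: F_def fun_eq_iff)
  have contF: "continuous_on ({0..1} \<times> ?A) (\<lambda>p. F (fst p) (snd p))"
  proof (rule continuous_on_coordinatewise_then_product)
    fix l
    have eval: "continuous_on ({0..1::real} \<times> ?A) (\<lambda>p. snd p l)"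
      by (rule continuous_on_product_then_coordinatewise) (intro continuous_intros)
    show "continuous_on ({0..1} \<times> ?A) (\<lambda>p. F (fst p) (snd p) l)"
    proof (cases "k \<le> l \<and> l < n")
      case True
      then have "continuous_on ({0..1::real} \<times> ?A) (\<lambda>p. \<theta> (snd p l))"
        by (intro continuous_on_compose2[OF \<theta> eval]) auto
      then have "continuous_on ({0..1::real} \<times> ?A) (\<lambda>p. cis ((1 - fst p) * \<theta> (snd p l)))"
        by (intro continuous_on_cis continuous_on_mult continuous_on_diff continuous_on_const continuous_on_fst continuous_on_id)
      then show ?thesis using True by (simp add: F_def)
    next
      case False
      then have "F t x l = x l" for t x by (auto simp: F_def)
      then show ?thesis using eval by presburger
    qed
  qed
  have sub: "subtopology (torus n) ?A = top_of_set ?A"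
    by (intro subtopology_torus) blast
  have "homotopic_with (\<lambda>_. True) (subtopology (torus n) ?A) (torus n) id (F 1)"
  proof (subst homotopic_with)
    show "\<exists>h. continuous_map (prod_topology (top_of_set {0..1::real}) (subtopology (torus n) ?A)) (torus n) h \<and>
        (\<forall>x\<in>topspace (subtopology (torus n) ?A). h (0, x) = id x) \<and>
        (\<forall>x\<in>topspace (subtopology (torus n) ?A). h (1, x) = F 1 x) \<and> (\<forall>t\<in>{0..1}. True)"
    proof (intro exI[of _ "\<lambda>p. F (fst p) (snd p)"] conjI ballI)
      have "(\<lambda>p. F (fst p) (snd p)) \<in> {0..1} \<times> ?A \<rightarrow> circle_power n"
        by (rule funcsetI, rule FT) (simp add: mem_Times_iff)
      then show "continuous_map (prod_topology (top_of_set {0..1::real}) (subtopology (torus n) ?A)) (torus n)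
          (\<lambda>p. F (fst p) (snd p))"
        using contF unfolding sub unfolding torus_eq_top_of_set
        by (simp add: continuous_map_in_subtopology)
    qed (simp_all add: sub F0)
  qed simp
  moreover have "F 1 ` ?A = subtorus n k"
  proof (intro equalityI subsetI)
    fix y assume "y \<in> F 1 ` ?A"
    then obtain x where "x \<in> circle_power n" "y = F 1 x" by blast
    moreover have "\<forall>l\<in>{k..<n}. F 1 x l = 1" by (simp add: F_def)
    ultimately show "y \<in> subtorus n k"
      using FT[of x 1] by (simp add: subtorus_def torus_eq_top_of_set)
  next
    fix y assume y: "y \<in> subtorus n k"
    obtain w where w: "w \<in> circle_arc N i" using circle_arc_nonempty[OF \<open>0 < N\<close>] by blast
    define x where "x = (\<lambda>l. if k \<le> l \<and> l < n then w else y l)"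
    have yT: "y \<in> circle_power n" and y1: "\<And>l. l \<in> {k..<n} \<Longrightarrow> y l = 1"
      using y by (simp_all add: subtorus_def torus_eq_top_of_set)
    have "norm w = 1" using w by (auto simp: circle_arc_def)
    have "x \<in> circle_power n"
    proof (rule PiE_I)
      show "x l \<in> sphere 0 1" if "l \<in> {..<n}" for l
        using PiE_mem[OF yT that] \<open>norm w = 1\<close> by (simp add: x_def)
      show "x l = undefined" if "l \<notin> {..<n}" for l
        using PiE_arb[OF yT that] that by (simp add: x_def)
    qed
    then have "x \<in> ?A" using w by (simp add: x_def)
    moreover have "F 1 x = y"
      using y1 by (simp add: F_def x_def fun_eq_iff)
    ultimately show "y \<in> F 1 ` ?A" by blast
  qed
  ultimately show "contractible_within_to (torus n) (subtorus n k) ?A"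
    unfolding contractible_within_to_def
    by (intro exI[of _ "F 1"]) (simp add: homeomorphic_space_refl)
qed

text \<open>Pigeonhole: each of the \<open>n - k\<close> coordinates rules out at most one of the \<open>n - k + 1\<close> indices.\<close>
lemma arc_products_cover:
  assumes "k \<le> n" "x \<in> circle_power n"
  shows "\<exists>i<n - k + 1. \<forall>l\<in>{k..<n}. x l \<in> circle_arc (n - k + 1) i"
proof -
  let ?N = "n - k + 1"
  define c where "c l = nat \<lfloor>?N * (Arg2pi (x l) / (2 * pi))\<rfloor>" for l
  have "card (c ` {k..<n}) < card {..<?N}"
    using card_image_le[of "{k..<n}" c] by simp
  then have "\<not> {..<?N} \<subseteq> c ` {k..<n}"
    by (metis card_mono finite_atLeastLessThan finite_imageI not_le)
  then obtain i where i: "i < ?N" "i \<notin> c ` {k..<n}" by blast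
  have "x l \<in> circle_arc ?N i" if l: "l \<in> {k..<n}" for l
  proof (rule mem_circle_arc)
    show "norm (x l) = 1" using PiE_mem[OF assms(2), of l] l by simp
    show "i \<noteq> nat \<lfloor>?N * (Arg2pi (x l) / (2 * pi))\<rfloor>" using i(2) l by (auto simp: c_def)
  qed (use i in auto)
  then show ?thesis using i(1) by blast
qed

theorem corollary1p15:
  fixes n k :: nat
  assumes "k \<le> n"
  shows "pcat (torus n) (subtorus n k) = enat (n - k + 1)"
proof -
  define covers where "covers m \<longleftrightarrow> (\<exists>A :: nat \<Rightarrow> (nat \<Rightarrow> complex) set.
     (\<forall>i\<in>{1..m}. closedin (torus n) (A i) \<and> contractible_within_to (torus n) (subtorus n k) (A i)) \<and>
     topspace (torus n) = (\<Union>i\<in>{1..m}. A i))" for m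
  have lower: "n - k + 1 \<le> m" if "covers m" for m
  proof -
    from that[unfolded covers_def] obtain A where
      A: "\<forall>i\<in>{1..m}. closedin (torus n) (A i) \<and> contractible_within_to (torus n) (subtorus n k) (A i)"
      and cover: "topspace (torus n) = (\<Union>i\<in>{1..m}. A i)"
      by (elim exE conjE)
    have "(\<Union>i\<in>{1..m}. A i) = (\<Union>i<m. A (Suc i))"
      unfolding image_Suc_lessThan[symmetric] image_image ..
    then have "n < m + k"
      using A cover by (intro contractible_cover_card_ge[OF assms, of m "\<lambda>i. A (Suc i)"]) simp_all
    then show ?thesis using assms by simp
  qed
  \<comment> \<open>The cover is indexed from 1, the arcs from 0; hence the shift.\<close>
  have upper: "covers (n - k + 1)"
    unfolding covers_def
  proof (intro exI[of _ "\<lambda>i. {x \<in> circle_power n. \<forall>l\<in>{k..<n}. x l \<in> circle_arc (n - k + 1) (i - 1)}"]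
      conjI ballI)
    show "topspace (torus n) = (\<Union>i\<in>{1..n - k + 1}.
        {x \<in> circle_power n. \<forall>l\<in>{k..<n}. x l \<in> circle_arc (n - k + 1) (i - 1)})"
    proof (intro equalityI subsetI)
      fix x assume "x \<in> topspace (torus n)"
      then have x: "x \<in> circle_power n" by (simp add: torus_eq_top_of_set)
      then obtain i where "i < n - k + 1" "\<forall>l\<in>{k..<n}. x l \<in> circle_arc (n - k + 1) i"
        using arc_products_cover[OF assms] by blast
      then show "x \<in> (\<Union>i\<in>{1..n - k + 1}.
          {x \<in> circle_power n. \<forall>l\<in>{k..<n}. x l \<in> circle_arc (n - k + 1) (i - 1)})"
        using x by (intro UN_I[of "Suc i"]) simp_all
    next
      fix x assume "x \<in> (\<Union>i\<in>{1..n - k + 1}.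
          {x \<in> circle_power n. \<forall>l\<in>{k..<n}. x l \<in> circle_arc (n - k + 1) (i - 1)})"
      then show "x \<in> topspace (torus n)" by (simp add: torus_eq_top_of_set)
    qed
  qed (intro contractible_within_to_arc_product assms; simp)+
  show ?thesis
    unfolding pcat_def covers_def[symmetric]
  proof (rule antisym)
    show "Inf {enat m |m. covers m} \<le> enat (n - k + 1)"
      using upper by (intro Inf_lower) blast
    show "enat (n - k + 1) \<le> Inf {enat m |m. covers m}"
      using lower by (intro Inf_greatest) auto
  qed
qed

end
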